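(* Let $G$ be a finite graph with girth $g \geq 7$ and minimum degree $\delta \geq 3$. Then $\sigma(G) \geq \delta + 1$.
   Context: Surrounding Cops and Robbers on a finite simple graph $G$ with $k \geq 1$ cops and one robber: the cops first choose starting vertices (several cops may share a vertex), then the robber chooses a starting vertex not occupied by a cop, and thereafter the cops and the robber alternate moves, the cops moving first. In a move, each player may move to an adjacent vertex or stay put (pass); the robber may never move to, or remain on, a vertex occupied by a cop, so if a cop moves onto the robber's vertex the robber is compelled to move to a neighbouring vertex not occupied by a cop. The cops win if at any time every neighbour of the robber's vertex is occupied by a cop; the robber wins if he avoids this forever. Play is with perfect information. The surrounding cop number $\sigma(G)$ is the least number $k$ of cops for which the cops have a winning strategy. *)

theory Defs
  imports "Graph_Theory.Pair_Digraph" "HOL-Library.Extended_Nat"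
begin

text \<open>
  A finite simple graph is a \<^locale>\<open>pair_graph\<close>: each undirected edge is represented by
  its two orientations. Hence the degree of a vertex is its out-degree, and since the
  digraph notion of a cycle admits the closed walk \<open>u, v, u\<close>, the cycles of the undirected
  graph are those of length at least 3. The girth of a forest is \<open>\<infinity>\<close>.
\<close>

definition girth :: "'a pair_pre_digraph \<Rightarrow> enat" where
  "girth G = (INF p \<in> {p. pre_digraph.cycle (with_proj G) p \<and> 3 \<le> length p}. enat (length p))"

definition min_degree :: "'a pair_pre_digraph \<Rightarrow> nat" where
  "min_degree G = Min (out_degree (with_proj G) ` pverts G)"

definition neighbours :: "'a pair_pre_digraph \<Rightarrow> 'a \<Rightarrow> 'a set" where
  "neighbours G v = {u. (v, u) \<in> parcs G}"

text \<open>
  The \<open>k\<close> cops are placed on a list of \<open>k\<close> vertices, with repetitions allowed; the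
  \<open>i\<close>-th entry is the position of the \<open>i\<close>-th cop.
\<close>

definition cop_placement :: "'a pair_pre_digraph \<Rightarrow> nat \<Rightarrow> 'a list \<Rightarrow> bool" where
  "cop_placement G k cs \<longleftrightarrow> length cs = k \<and> set cs \<subseteq> pverts G"

definition step :: "'a pair_pre_digraph \<Rightarrow> 'a \<Rightarrow> 'a \<Rightarrow> bool" where
  "step G u v \<longleftrightarrow> v = u \<or> v \<in> neighbours G u"

definition cop_move :: "'a pair_pre_digraph \<Rightarrow> 'a list \<Rightarrow> 'a list \<Rightarrow> bool" where
  "cop_move G cs cs' \<longleftrightarrow> list_all2 (step G) cs cs'"

definition robber_move :: "'a pair_pre_digraph \<Rightarrow> 'a list \<Rightarrow> 'a \<Rightarrow> 'a \<Rightarrow> bool" where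
  "robber_move G cs r r' \<longleftrightarrow> step G r r' \<and> r' \<notin> set cs"

definition surrounded :: "'a pair_pre_digraph \<Rightarrow> 'a list \<Rightarrow> 'a \<Rightarrow> bool" where
  "surrounded G cs r \<longleftrightarrow> neighbours G r \<subseteq> set cs"

text \<open>
  A history lists the positions (cops, robber) at the ends of the rounds played so far.
  A strategy maps the empty history to the initial placement of the cops and a non-empty
  history to the placement after their next move. Legality is demanded on all histories,
  since a strategy could otherwise stop the robber by an illegal move.
\<close>

definition cop_strategy ::
    "'a pair_pre_digraph \<Rightarrow> nat \<Rightarrow> (('a list \<times> 'a) list \<Rightarrow> 'a list) \<Rightarrow> bool" where
  "cop_strategy G k S \<longleftrightarrow> cop_placement G k (S []) \<and>
     (\<forall>h cs r. cop_placement G k cs \<longrightarrow> r \<in> pverts G \<longrightarrow> cop_move G cs (S (h @ [(cs, r)])))"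

text \<open>
  In round \<open>n + 1\<close> the cops move from \<open>C n\<close> to \<open>C (n + 1)\<close>, then the robber moves from
  \<open>R n\<close> to \<open>R (n + 1)\<close>. Only infinite plays are considered: a play can break off only if
  the robber has no legal start (all vertices are occupied) or no legal move, and in the
  latter case he is surrounded. Both count as wins for the cops.
\<close>

definition play ::
    "'a pair_pre_digraph \<Rightarrow> (('a list \<times> 'a) list \<Rightarrow> 'a list) \<Rightarrow>
      (nat \<Rightarrow> 'a list) \<Rightarrow> (nat \<Rightarrow> 'a) \<Rightarrow> bool" where
  "play G S C R \<longleftrightarrow>
     C 0 = S [] \<and> R 0 \<in> pverts G \<and> R 0 \<notin> set (C 0) \<and>
     (\<forall>n. C (Suc n) = S (map (\<lambda>i. (C i, R i)) [0..<Suc n]) \<and>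
          robber_move G (C (Suc n)) (R n) (R (Suc n)))"

definition cop_win_play ::
    "'a pair_pre_digraph \<Rightarrow> (nat \<Rightarrow> 'a list) \<Rightarrow> (nat \<Rightarrow> 'a) \<Rightarrow> bool" where
  "cop_win_play G C R \<longleftrightarrow>
     (\<exists>n. surrounded G (C n) (R n) \<or> surrounded G (C (Suc n)) (R n))"

definition cops_win :: "'a pair_pre_digraph \<Rightarrow> nat \<Rightarrow> bool" where
  "cops_win G k \<longleftrightarrow>
     (\<exists>S. cop_strategy G k S \<and> (\<forall>C R. play G S C R \<longrightarrow> cop_win_play G C R))"

definition surrounding_cop_number :: "'a pair_pre_digraph \<Rightarrow> nat" where
  "surrounding_cop_number G = (LEAST k. 1 \<le> k \<and> cops_win G k)"

lemma robber_move_if_not_surrounded: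
  assumes "\<not> surrounded G cs r"
  shows "\<exists>r'. robber_move G cs r r'"
  using assms by (auto simp: surrounded_def robber_move_def step_def)

lemma cops_win_card_verts:
  assumes "finite (pverts G)"
  shows "cops_win G (card (pverts G))"
proof -
  obtain vs where vs: "set vs = pverts G" "length vs = card (pverts G)"
    using finite_distinct_list[OF assms] distinct_card by metis
  define S :: "('a list \<times> 'a) list \<Rightarrow> 'a list"
    where "S h = (if h = [] then vs else fst (last h))" for h
  have "cop_strategy G (card (pverts G)) S"
    using vs
    by (auto simp: cop_strategy_def cop_placement_def cop_move_def S_def step_def
        intro: list_all2_refl)
  moreover have "\<not> play G S C R" for C R
    using vs by (auto simp: play_def S_def)
  ultimately show ?thesis
    unfolding cops_win_def by blast
qed

lemma surrounding_cop_number_attained: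
  assumes "finite (pverts G)" "pverts G \<noteq> {}"
  shows "1 \<le> surrounding_cop_number G" "cops_win G (surrounding_cop_number G)"
proof -
  have "1 \<le> card (pverts G) \<and> cops_win G (card (pverts G))"
    using cops_win_card_verts[OF assms(1)] assms by (simp add: Suc_le_eq card_gt_0_iff)
  from LeastI[of "\<lambda>k. 1 \<le> k \<and> cops_win G k", OF this]
  show "1 \<le> surrounding_cop_number G" "cops_win G (surrounding_cop_number G)"
    by (simp_all add: surrounding_cop_number_def)
qed

end

theory Submission
  imports Defs
begin

text \<open>
  With at most \<open>\<delta>\<close> cops, the robber keeps the invariant that the cops cannot surround him
  by their next move. If an unoccupied vertex \<open>r\<close> violates it, then the cops are matched
  bijectively to the neighbours of \<open>r\<close>, each cop being on or adjacent to its neighbour.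
  Two such matchings, for different vertices near \<open>r\<close>, would close a cycle of length at
  most 6. So if \<open>r\<close> is unoccupied but threatened, every free neighbour of \<open>r\<close> is safe; and
  if a cop has moved onto \<open>r\<close>, one of two neighbours of \<open>r\<close> is free and safe.
\<close>

section \<open>Neighbourhoods and cop moves in a finite simple graph\<close>

context pair_graph
begin

lemma neighbours_sym: "v \<in> neighbours G u \<Longrightarrow> u \<in> neighbours G v"
  by (simp add: neighbours_def arcs_symmetric)

lemma neighbours_irrefl: "v \<in> neighbours G u \<Longrightarrow> v \<noteq> u"
  by (auto simp: neighbours_def dest: no_loops')

lemma neighbours_in_verts: "v \<in> neighbours G u \<Longrightarrow> v \<in> pverts G"
  by (auto simp: neighbours_def dest: in_arcsD2)

lemma finite_neighbours: "finite (neighbours G v)"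
  by (rule finite_subset[OF _ finite_verts]) (auto dest: neighbours_in_verts)

lemma card_neighbours_ge_min_degree:
  assumes "v \<in> pverts G"
  shows "min_degree G \<le> card (neighbours G v)"
proof -
  have "out_arcs (with_proj G) v = Pair v ` neighbours G v"
    by (auto simp: out_arcs_def neighbours_def)
  then have "out_degree (with_proj G) v = card (neighbours G v)"
    by (simp add: out_degree_def card_image inj_on_def)
  moreover have "min_degree G \<le> out_degree (with_proj G) v"
    unfolding min_degree_def using assms finite_verts by (intro Min_le) auto
  ultimately show ?thesis by simp
qed

lemma cop_move_placement:
  assumes "cop_placement G k cs" "cop_move G cs cs'"
  shows "cop_placement G k cs'"
  using assms
  by (fastforce simp: cop_placement_def cop_move_def list_all2_conv_all_nth step_def
      set_conv_nth dest: neighbours_in_verts)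

end

section \<open>At most \<delta> cops on a graph without short cycles\<close>

locale surrounding_game = pair_graph G for G :: "'a pair_pre_digraph" +
  fixes k :: nat
  assumes girth: "7 \<le> girth G"
    and min_degree: "3 \<le> min_degree G"
    and few_cops: "k \<le> min_degree G"
begin

abbreviation adj :: "'a \<Rightarrow> 'a \<Rightarrow> bool" where
  "adj u v \<equiv> v \<in> neighbours G u"

lemma cycle_length_ge_7:
  assumes "cycle p" "3 \<le> length p"
  shows "7 \<le> length p"
proof -
  have "girth G \<le> enat (length p)"
    unfolding girth_def using assms by (intro INF_lower) auto
  with girth have "7 \<le> enat (length p)" by (rule order_trans)
  then show ?thesis by (simp add: numeral_eq_enat)
qed

lemma no_3_cycle:
  assumes "adj b a" "adj c b" "adj a c"
  shows False
proof -
  have "cycle [(a, c), (c, b), (b, a)]"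
    using assms assms[THEN neighbours_irrefl] assms[THEN neighbours_in_verts]
    by (auto simp: cycle_def awalk_def neighbours_def)
  then show False using cycle_length_ge_7 by fastforce
qed

lemma no_4_cycle:
  assumes "adj b a" "adj c b" "adj d c" "adj a d" "a \<noteq> c" "b \<noteq> d"
  shows False
proof -
  have "cycle [(a, d), (d, c), (c, b), (b, a)]"
    using assms assms(1-4)[THEN neighbours_irrefl] assms(1-4)[THEN neighbours_in_verts]
    by (auto simp: cycle_def awalk_def neighbours_def)
  then show False using cycle_length_ge_7 by fastforce
qed

text \<open>Distinctness comes for free: identifying two non-consecutive vertices of a closed walk
  of length 5 leaves a triangle.\<close>

lemma no_5_cycle:
  assumes "adj b a" "adj c b" "adj d c" "adj e d" "adj a e"
  shows False
proof -
  have "distinct [a, b, c, d, e]"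
    using assms assms[THEN neighbours_irrefl] no_3_cycle by auto
  then have "cycle [(a, e), (e, d), (d, c), (c, b), (b, a)]"
    using assms assms[THEN neighbours_in_verts]
    by (auto simp: cycle_def awalk_def neighbours_def)
  then show False using cycle_length_ge_7 by fastforce
qed

lemma no_6_cycle:
  assumes "adj b a" "adj c b" "adj d c" "adj e d" "adj f e" "adj a f"
    and "distinct [a, b, c, d, e, f]"
  shows False
proof -
  have "cycle [(a, f), (f, e), (e, d), (d, c), (c, b), (b, a)]"
    using assms assms(1-6)[THEN neighbours_in_verts]
    by (auto simp: cycle_def awalk_def neighbours_def)
  then show False using cycle_length_ge_7 by fastforce
qed

text \<open>If \<open>c\<close> is one of \<open>u\<close>, \<open>v\<close>, there would be a
  triangle through \<open>r\<close>; otherwise \<open>r, u, c, v\<close> would be a 4-cycle. This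
  leaves each cop off \<open>r\<close> at most one neighbour of \<open>r\<close> as a
  target.\<close>

lemma step_common_neighbour_unique:
  assumes "adj r u" "adj r v" "step G c u" "step G c v" "c \<noteq> r"
  shows "u = v"
  using assms no_3_cycle[of r u v] no_4_cycle[of r u c v] unfolding step_def
  by (metis neighbours_sym)

section \<open>Safe vertices and matchings of cops to neighbours\<close>

definition safe :: "'a list \<Rightarrow> 'a \<Rightarrow> bool" where
  "safe cs r \<longleftrightarrow> (\<forall>cs'. cop_move G cs cs' \<longrightarrow> \<not> surrounded G cs' r)"

text \<open>The cops may all pass, so a threat already carried out counts as a threat.\<close>

lemma safe_not_surrounded: "safe cs r \<Longrightarrow> \<not> surrounded G cs r"
  unfolding safe_def cop_move_def by (metis list_all2_refl step_def)

text \<open>The chain \<open>k\<close> \<le> \<delta> \<le> deg \<open>r\<close> \<le>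
  \<open>card (set cs)\<close> \<le> \<open>k\<close> collapses to equalities.\<close>

lemma surrounded_tight:
  assumes "length cs = k" "r \<in> pverts G" "surrounded G cs r"
  shows "distinct cs" "set cs = neighbours G r" "3 \<le> length cs"
proof -
  have le: "length cs \<le> card (neighbours G r)"
    using assms(1,2) few_cops card_neighbours_ge_min_degree by fastforce
  have sub: "neighbours G r \<subseteq> set cs" using assms(3) by (simp add: surrounded_def)
  then have "card (neighbours G r) \<le> card (set cs)" by (simp add: card_mono)
  with le card_length[of cs] have eq: "card (set cs) = length cs" "card (neighbours G r) = card (set cs)"
    by auto
  show "distinct cs" using eq by (simp add: card_distinct)
  show "set cs = neighbours G r" using sub eq by (metis card_subset_eq List.finite_set)
  show "3 \<le> length cs"
    using eq min_degree card_neighbours_ge_min_degree[OF assms(2)] by simp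
qed

text \<open>The matching is a map on occupied vertices rather than on indices, so that matchings for
  two different robber vertices can be compared at the same cop.\<close>

lemma unsafe_matching:
  assumes len: "length cs = k" and r: "r \<in> pverts G" "r \<notin> set cs" and "\<not> safe cs r"
  obtains f where "inj_on f (set cs)" "f ` set cs = neighbours G r"
    "\<And>c. c \<in> set cs \<Longrightarrow> step G c (f c)" "3 \<le> card (set cs)"
proof -
  obtain cs' where mv: "cop_move G cs cs'" and sur: "surrounded G cs' r"
    using assms(4) by (auto simp: safe_def)
  have len': "length cs' = length cs"
    using mv by (simp add: cop_move_def list_all2_lengthD)
  have tight: "distinct cs'" "set cs' = neighbours G r" "3 \<le> length cs'"
    using surrounded_tight[OF _ r(1) sur] len len' by auto
  have nth_step: "step G (cs ! i) (cs' ! i)" if "i < length cs" for i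
    using mv that by (simp add: cop_move_def list_all2_conv_all_nth)
  \<comment> \<open>Well-defined on \<open>set cs\<close> because \<open>r\<close> is free and a cop
    off \<open>r\<close> reaches at most one neighbour of \<open>r\<close>.\<close>
  define f where "f c = (THE u. u \<in> neighbours G r \<and> step G c u)" for c
  have f_nth: "f (cs ! i) = cs' ! i" if "i < length cs" for i
    unfolding f_def
  proof (rule the_equality)
    show ex: "cs' ! i \<in> neighbours G r \<and> step G (cs ! i) (cs' ! i)"
      using nth_step[OF that] tight(2) len' that nth_mem by metis
    show "u = cs' ! i" if "u \<in> neighbours G r \<and> step G (cs ! i) u" for u
      using step_common_neighbour_unique[of u r "cs' ! i" "cs ! i"] ex that r(2)
        nth_mem[OF \<open>i < length cs\<close>] by auto
  qed
  \<comment> \<open>As \<open>cs'\<close> is distinct, this makes \<open>cs\<close> distinct and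
    \<open>f\<close> injective on it.\<close>
  have map_f: "map f cs = cs'"
    using f_nth len' by (auto intro: nth_equalityI)
  then have dist: "distinct cs" "inj_on f (set cs)"
    using tight(1) by (auto simp: distinct_map)
  show thesis
  proof
    show "inj_on f (set cs)" by (fact dist)
    show "f ` set cs = neighbours G r" using map_f tight(2) by (metis set_map)
    show "step G c (f c)" if "c \<in> set cs" for c
      using that nth_step f_nth by (metis in_set_conv_nth)
    show "3 \<le> card (set cs)" using dist tight(3) len' by (simp add: distinct_card)
  qed
qed

text \<open>The two matchings \<open>f\<close> for \<open>r\<close> and \<open>g\<close> for
  \<open>u\<close> send some third cop to neighbours of both ends of the edge \<open>r u\<close>,
  which closes a cycle of length at most 5.\<close>

lemma safe_neighbour_of_unsafe:
  assumes len: "length cs = k" and r: "r \<in> pverts G" "r \<notin> set cs" and unsafe: "\<not> safe cs r"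
    and u: "adj r u" "u \<notin> set cs"
  shows "safe cs u"
proof (rule ccontr)
  assume "\<not> safe cs u"
  obtain f where f: "inj_on f (set cs)" "f ` set cs = neighbours G r"
    "\<And>c. c \<in> set cs \<Longrightarrow> step G c (f c)" "3 \<le> card (set cs)"
    by (rule unsafe_matching[OF len r unsafe]) (rule that)
  obtain g where g: "inj_on g (set cs)" "g ` set cs = neighbours G u"
    "\<And>c. c \<in> set cs \<Longrightarrow> step G c (g c)" "3 \<le> card (set cs)"
    by (rule unsafe_matching[OF len neighbours_in_verts[OF u(1)] u(2) \<open>\<not> safe cs u\<close>]) (rule that)
  obtain a where a: "a \<in> set cs" "f a = u" using f(2) u(1) by (metis imageE)
  obtain b where b: "b \<in> set cs" "g b = r" using g(2) neighbours_sym[OF u(1)] by (metis imageE)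
  \<comment> \<open>Of at least three cops, one is matched neither to \<open>u\<close> by
    \<open>f\<close> nor to \<open>r\<close> by \<open>g\<close>.\<close>
  have "\<not> set cs \<subseteq> {a, b}"
    using card_mono[of "{a, b}" "set cs"] card_insert_le_m1[of 2 "{b}" a] f(4) by auto
  then obtain c where c: "c \<in> set cs" "f c \<noteq> u" "g c \<noteq> r"
    using a b f(1) g(1) by (auto dest: inj_onD)
  have "adj r (f c)" "adj u (g c)" "step G c (f c)" "step G c (g c)"
    using f g c by auto
  \<comment> \<open>The closed walk is \<open>r, u, g c, c, f c\<close>; it shortens to a 4-cycle or
    a triangle when \<open>c\<close> coincides with one or both of its targets.\<close>
  then show False
    using u c r(2) no_3_cycle[of r u "f c"] no_4_cycle[of r u "g c" "f c"]
      no_5_cycle[of r u "g c" c "f c"]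
    unfolding step_def by (metis neighbours_sym)
qed

lemma robber_escapes:
  assumes len: "length cs = k" and r: "r \<in> pverts G" and "\<not> surrounded G cs r"
  shows "\<exists>r'. robber_move G cs r r' \<and> safe cs r'"
proof -
  obtain u where u: "adj r u" "u \<notin> set cs"
    using assms(3) by (auto simp: surrounded_def)
  have move: "robber_move G cs r v" if "adj r v" "v \<notin> set cs" for v
    using that by (simp add: robber_move_def step_def)
  consider "r \<notin> set cs" "safe cs r" | "r \<notin> set cs" "\<not> safe cs r" | "r \<in> set cs" "safe cs u"
    | "r \<in> set cs" "\<not> safe cs u" by blast
  then show ?thesis
  proof cases
    case 1
    then show ?thesis by (auto simp: robber_move_def step_def)
  next
    case 2
    then show ?thesis using safe_neighbour_of_unsafe[OF len r] u move by blast
  next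
    case 3
    then show ?thesis using u move by blast
  next
    case 4
    obtain g where g: "inj_on g (set cs)" "g ` set cs = neighbours G u"
      "\<And>c. c \<in> set cs \<Longrightarrow> step G c (g c)" "3 \<le> card (set cs)"
      by (rule unsafe_matching[OF len neighbours_in_verts[OF u(1)] u(2) 4(2)]) (rule that)
    \<comment> \<open>Since \<open>r\<close> is a neighbour of \<open>u\<close> and \<open>c\<close>
      is not the free vertex \<open>u\<close>, uniqueness of targets applies around
      \<open>u\<close>.\<close>
    have g_r: "g c = r" if "c \<in> set cs" "step G c r" for c
      using step_common_neighbour_unique[of "g c" u r c] g(2,3) that u neighbours_sym[OF u(1)]
      by blast
    have "\<not> neighbours G r \<subseteq> {u}"
      using card_mono[of "{u}" "neighbours G r"] card_neighbours_ge_min_degree[OF r] min_degree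
      by auto
    then obtain v where v: "adj r v" "v \<noteq> u" by blast
    \<comment> \<open>Otherwise the cops on \<open>r\<close> and on \<open>v\<close> would both be
      matched to \<open>r\<close>.\<close>
    have v_free: "v \<notin> set cs"
    proof
      assume "v \<in> set cs"
      then have "g v = g r" using g_r 4(1) v(1) neighbours_sym by (simp add: step_def)
      then show False using g(1) 4(1) \<open>v \<in> set cs\<close> v(1) neighbours_irrefl
        by (auto dest: inj_onD)
    qed
    have "safe cs v"
    proof (rule ccontr)
      assume "\<not> safe cs v"
      obtain h where h: "inj_on h (set cs)" "h ` set cs = neighbours G v"
        "\<And>c. c \<in> set cs \<Longrightarrow> step G c (h c)" "3 \<le> card (set cs)"
        by (rule unsafe_matching[OF len neighbours_in_verts[OF v(1)] v_free \<open>\<not> safe cs v\<close>])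
          (rule that)
      have h_r: "h r = r"
        using step_common_neighbour_unique[of "h r" v r r] h(2,3) 4(1) neighbours_sym[OF v(1)]
          neighbours_irrefl[OF v(1)] by (auto simp: step_def)
      have "\<not> set cs \<subseteq> {r}"
        using card_mono[of "{r}" "set cs"] g(4) by auto
      then obtain c where c: "c \<in> set cs" "c \<noteq> r" by blast
      \<comment> \<open>In both matchings the target \<open>r\<close> is used up by the cop standing
        there.\<close>
      have ne: "g c \<noteq> r" "h c \<noteq> r"
        using g_r[OF 4(1)] h_r g(1) h(1) c 4(1) by (auto simp: step_def dest: inj_onD)
      have a: "adj u (g c)" "adj v (h c)" "step G c (g c)" "step G c (h c)"
        using g h c by auto
      have cuv: "c \<noteq> u" "c \<noteq> v" using c u v_free by auto
      have gh: "g c \<noteq> h c"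
        using no_4_cycle[of r u "g c" v] a u v ne by (metis neighbours_sym)
      have far: "g c \<noteq> u" "g c \<noteq> v" "h c \<noteq> u" "h c \<noteq> v" "r \<noteq> u" "r \<noteq> v"
        using a u(1) v(1) no_3_cycle[of r u v] by (metis neighbours_irrefl neighbours_sym)+
      \<comment> \<open>The vertices \<open>r, u, g c, c, h c, v\<close> form a 6-cycle, or a
        5-cycle if \<open>c\<close> is \<open>g c\<close> or \<open>h c\<close>.\<close>
      show False
        using a gh far ne cuv c u v no_5_cycle[of r u "g c" "h c" v]
          no_6_cycle[of r u "g c" c "h c" v]
        unfolding step_def distinct_length_2_or_more
        by (metis distinct_singleton neighbours_sym)
    qed
    then show ?thesis using v(1) v_free move by blast
  qed
qed

lemma safe_start:
  assumes cs: "cop_placement G k cs" and "pverts G \<noteq> {}"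
  shows "\<exists>r. r \<in> pverts G \<and> r \<notin> set cs \<and> safe cs r"
proof -
  have len: "length cs = k" using cs by (simp add: cop_placement_def)
  obtain x where x: "x \<in> pverts G" using assms(2) by blast
  \<comment> \<open>The closed neighbourhood has at least \<delta> + 1 vertices, too many for the
    cops to fill.\<close>
  have "card (insert x (neighbours G x)) > card (set cs)"
    using card_neighbours_ge_min_degree[OF x] few_cops card_length[of cs] len
      finite_neighbours neighbours_irrefl by (subst card_insert_disjoint) auto
  then have "\<not> insert x (neighbours G x) \<subseteq> set cs"
    using card_mono[of "set cs"] by (meson List.finite_set not_le)
  then obtain v where v: "v \<in> pverts G" "v \<notin> set cs"
    using x neighbours_in_verts by blast
  show ?thesis
  proof (cases "surrounded G cs v")
    case False
    \<comment> \<open>Here \<open>v\<close> serves as a fictitious robber position, from which the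
      escape move leads to a free safe vertex.\<close>
    then obtain r where "robber_move G cs v r" "safe cs r"
      using robber_escapes[OF len v(1)] by blast
    then show ?thesis using v(1)
      by (auto simp: robber_move_def step_def dest: neighbours_in_verts)
  next
    case True
    note tight = surrounded_tight[OF len v(1) True]
    have big: "3 \<le> card (neighbours G y)" if "y \<in> pverts G" for y
      using card_neighbours_ge_min_degree[OF that] min_degree by simp
    have other: "\<exists>w. adj y w \<and> w \<noteq> z" if "y \<in> pverts G" for y z
      using card_mono[of "{z}" "neighbours G y"] big[OF that] by auto
    obtain u where u: "adj v u" using other[OF v(1)] by blast
    obtain u' where u': "adj v u'" "u' \<noteq> u" using other[OF v(1)] by blast
    \<comment> \<open>The cops fill exactly the neighbourhood of \<open>v\<close>, so a vertex at
      distance 2 from \<open>v\<close> is free. A threat to \<open>w\<close> would need the cop on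
      \<open>u'\<close>, closing a cycle of length 4 or 5.\<close>
    obtain w where w: "adj u w" "w \<noteq> v" using other[OF neighbours_in_verts[OF u]] by blast
    have w_free: "w \<notin> set cs"
      using tight(2) no_3_cycle[of v u w] u w by (metis neighbours_sym)
    have "safe cs w"
    proof (rule ccontr)
      assume "\<not> safe cs w"
      obtain g where g: "inj_on g (set cs)" "g ` set cs = neighbours G w"
        "\<And>c. c \<in> set cs \<Longrightarrow> step G c (g c)" "3 \<le> card (set cs)"
        by (rule unsafe_matching[OF len neighbours_in_verts[OF w(1)] w_free \<open>\<not> safe cs w\<close>])
          (rule that)
      have "u' \<in> set cs" using u' tight(2) by simp
      then have "adj w (g u')" "step G u' (g u')" using g(2,3) by auto
      then show False
        using u u' w no_4_cycle[of v u w u'] no_5_cycle[of v u w "g u'" u']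
        unfolding step_def by (metis neighbours_sym)
    qed
    then show ?thesis using w_free neighbours_in_verts[OF w(1)] by blast
  qed
qed

text \<open>Strategies see the whole past, so the play is built as a chain of growing histories
  whose last position is always safe.\<close>

lemma robber_evades_strategy:
  assumes S: "cop_strategy G k S" and "pverts G \<noteq> {}"
  shows "\<exists>C R. play G S C R \<and> \<not> cop_win_play G C R"
proof -
  define good where "good = (\<lambda>(cs, r). cop_placement G k cs \<and> r \<in> pverts G \<and> safe cs r)"
  obtain r0 where r0: "r0 \<in> pverts G" "r0 \<notin> set (S [])" "safe (S []) r0"
    using safe_start assms unfolding cop_strategy_def by blast
  define ext where "ext h h' \<longleftrightarrow>
    (\<exists>r'. h' = h @ [(S h, r')] \<and> robber_move G (S h) (snd (last h)) r')" for h h'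
  \<comment> \<open>The clause for \<open>n = 0\<close> pins the start of the chain, which dependent
    choice alone would leave open.\<close>
  have "\<exists>H. \<forall>n. ((H n \<noteq> [] \<and> good (last (H n))) \<and> (n = 0 \<longrightarrow> H n = [(S [], r0)])) \<and>
      ext (H n) (H (Suc n))"
  proof (rule dependent_nat_choice)
    show "\<exists>h. (h \<noteq> [] \<and> good (last h)) \<and> (0 = (0::nat) \<longrightarrow> h = [(S [], r0)])"
      using r0 S by (intro exI[of _ "[(S [], r0)]"]) (auto simp: good_def cop_strategy_def)
  next
    fix h :: "('a list \<times> 'a) list" and n :: nat
    assume h: "(h \<noteq> [] \<and> good (last h)) \<and> (n = 0 \<longrightarrow> h = [(S [], r0)])"
    obtain cs r where last: "last h = (cs, r)" by fastforce
    then have inv: "cop_placement G k cs" "r \<in> pverts G" "safe cs r"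
      using h by (auto simp: good_def)
    \<comment> \<open>Brings \<open>h\<close> into the form in which \<open>cop_strategy\<close>
      guarantees a legal move.\<close>
    have "h = butlast h @ [(cs, r)]" using h last by (metis append_butlast_last_id)
    then have mv: "cop_move G cs (S h)"
      using S inv unfolding cop_strategy_def by metis
    then have place: "cop_placement G k (S h)" using inv cop_move_placement by blast
    have "\<not> surrounded G (S h) r" using inv mv by (simp add: safe_def)
    then obtain r' where r': "robber_move G (S h) r r'" "safe (S h) r'"
      using robber_escapes place inv(2) unfolding cop_placement_def by blast
    then have "r' \<in> pverts G"
      using inv(2) by (auto simp: robber_move_def step_def dest: neighbours_in_verts)
    then show "\<exists>h'. ((h' \<noteq> [] \<and> good (last h')) \<and> (Suc n = 0 \<longrightarrow> h' = [(S [], r0)])) \<and> ext h h'"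
      using r' place last
      by (intro exI[of _ "h @ [(S h, r')]"]) (auto simp: good_def ext_def)
  qed
  then obtain H where H: "\<And>n. H n \<noteq> []" "\<And>n. good (last (H n))" "H 0 = [(S [], r0)]"
    "\<And>n. ext (H n) (H (Suc n))" by blast
  define C where "C n = fst (last (H n))" for n
  define R where "R n = snd (last (H n))" for n
  \<comment> \<open>\<open>H n\<close> has \<open>n + 1\<close> entries, matching the history that
    \<open>play\<close> feeds to \<open>S\<close> for \<open>C (Suc n)\<close>.\<close>
  have H_eq: "H n = map (\<lambda>i. (C i, R i)) [0..<Suc n]" for n
  proof (induction n)
    case 0
    then show ?case using H(3) by (simp add: C_def R_def)
  next
    case (Suc n)
    have "H (Suc n) = H n @ [(C (Suc n), R (Suc n))]"
      using H(4)[of n] by (auto simp: ext_def C_def R_def)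
    also have "\<dots> = map (\<lambda>i. (C i, R i)) [0..<Suc (Suc n)]" by (subst Suc) simp
    finally show ?case .
  qed
  have next_round: "C (Suc n) = S (H n)" "robber_move G (C (Suc n)) (R n) (R (Suc n))" for n
    using H(4)[of n] by (auto simp: ext_def C_def R_def)
  have inv: "cop_placement G k (C n)" "R n \<in> pverts G" "safe (C n) (R n)" for n
    using H(2)[of n] by (auto simp: good_def C_def R_def split: prod.splits)
  have start: "C 0 = S []" "R 0 = r0" using H(3) by (simp_all add: C_def R_def)
  have "play G S C R"
    unfolding play_def start H_eq[symmetric] using r0 next_round by simp
  moreover have "\<not> surrounded G (C (Suc n)) (R n)" for n
  proof -
    have "H n = map (\<lambda>i. (C i, R i)) [0..<n] @ [(C n, R n)]" by (simp add: H_eq)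
    then have "cop_move G (C n) (C (Suc n))"
      using S inv[of n] next_round(1)[of n] unfolding cop_strategy_def by metis
    then show ?thesis using inv(3) by (simp add: safe_def)
  qed
  ultimately show ?thesis
    using inv(3) safe_not_surrounded unfolding cop_win_play_def by blast
qed

end

theorem theorem7:
  fixes G :: "'a pair_pre_digraph"
  assumes "pair_graph G"
    and "pverts G \<noteq> {}"
    and "girth G \<ge> 7"
    and "min_degree G \<ge> 3"
  shows "surrounding_cop_number G \<ge> min_degree G + 1"
proof (rule ccontr)
  interpret pair_graph G by fact
  assume "\<not> ?thesis"
  \<comment> \<open>The negated claim supplies \<open>few_cops\<close> for a number of cops that
    does win.\<close>
  then interpret surrounding_game G "surrounding_cop_number G"
    using assms by unfold_locales auto
  obtain S where "cop_strategy G (surrounding_cop_number G) S"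
    "\<forall>C R. play G S C R \<longrightarrow> cop_win_play G C R"
    using surrounding_cop_number_attained(2)[OF finite_verts assms(2)]
    unfolding cops_win_def by blast
  then show False using robber_evades_strategy assms(2) by blast
qed

end
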